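(* Let $J\in L^1_{\delta_0}(\mathbb{R}^n)$ ($\delta_0\ge2$) be radially symmetric, let $b\in\mathbb{R}$ with $|b|\le\delta_0-2$, let $\alpha_0=\|J\|_{L^1}$, and for $\eta\ge2$ let $\Lambda(x)=(1+|x|^2/\eta)^{1/2}$. Then there is a constant $d=d(b,J)>0$ (independent of $\eta$ and $x$) such that $$\left|\int_{\mathbb{R}^n}|J(x-y)|\Lambda(y)^b\,dy-\alpha_0\Lambda(x)^b\right|\le\frac{d}{\eta}\Lambda(x)^b\qquad(\forall\,x\in\mathbb{R}^n).$$ In fact, one can take $d=C_b\|J\|_{L^1_{2+|b|}}$ with a constant $C_b$ depending on $b$, and one can take $C_b=0$ if $b=0$.
   Context: Notation: $\langle x\rangle=(1+|x|^2)^{1/2}$; $L^1_b(\mathbb{R}^n)$ is the set of measurable $f:\mathbb{R}^n\to\mathbb{R}$ with $\|f\|_{L^1_b}:=\|\langle\cdot\rangle^b f\|_{L^1}<\infty$. *)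

theory Defs
  imports "HOL-Analysis.Analysis"
begin

definition japanese_bracket :: "real ^ 'n \<Rightarrow> real" where
  "japanese_bracket x = sqrt (1 + (norm x)\<^sup>2)"

text \<open>Measurability and integrals are with respect to Lebesgue (not just Borel) measurable
  functions. Since \<open>integrable\<close> means measurable with finite integral of the absolute value,
  the second condition says exactly that the weighted norm is finite.\<close>

definition weighted_L1 :: "real \<Rightarrow> (real ^ 'n \<Rightarrow> real) set" where
  "weighted_L1 a = {f. f \<in> borel_measurable lebesgue \<and>
     integrable lebesgue (\<lambda>x. japanese_bracket x powr a * f x)}"

definition weighted_L1_norm :: "real \<Rightarrow> (real ^ 'n \<Rightarrow> real) \<Rightarrow> real" where
  "weighted_L1_norm a f = (LINT x|lebesgue. \<bar>japanese_bracket x powr a * f x\<bar>)"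

definition L1_norm :: "(real ^ 'n \<Rightarrow> real) \<Rightarrow> real" where
  "L1_norm f = (LINT x|lebesgue. \<bar>f x\<bar>)"

definition radially_symmetric :: "(real ^ 'n \<Rightarrow> real) \<Rightarrow> bool" where
  "radially_symmetric f \<longleftrightarrow> (\<forall>x y. norm x = norm y \<longrightarrow> f x = f y)"

definition scaled_bracket :: "real \<Rightarrow> real ^ 'n \<Rightarrow> real" where
  "scaled_bracket \<eta> x = sqrt (1 + (norm x)\<^sup>2 / \<eta>)"

text \<open>The Bochner integral of a non-integrable function is 0 by convention, so the finiteness
  of the convolution integral, implicit in the informal estimate, is stated explicitly.\<close>

definition convolution_estimate :: "(real ^ 'n \<Rightarrow> real) \<Rightarrow> real \<Rightarrow> real \<Rightarrow> bool" where
  "convolution_estimate J b d \<longleftrightarrow> (\<forall>\<eta>\<ge>2. \<forall>x.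
     integrable lebesgue (\<lambda>y. \<bar>J (x - y)\<bar> * scaled_bracket \<eta> y powr b) \<and>
     \<bar>(LINT y|lebesgue. \<bar>J (x - y)\<bar> * scaled_bracket \<eta> y powr b)
        - L1_norm J * scaled_bracket \<eta> x powr b\<bar>
      \<le> d / \<eta> * scaled_bracket \<eta> x powr b)"

end

theory Submission imports Defs begin

text \<open>Substituting \<open>z = x - y\<close> and using that \<open>J\<close> is even, twice the quantity to be estimated is the
  integral of \<open>\<bar>J z\<bar>\<close> against the second difference
  \<open>\<Lambda>(x + z)\<^sup>b + \<Lambda>(x - z)\<^sup>b - 2 \<Lambda>(x)\<^sup>b\<close>. With \<open>u = x / \<surd>\<eta>\<close> and \<open>v = z / \<surd>\<eta>\<close> this is a second
  difference of \<open>(1 + \<bar>u\<bar>\<^sup>2)\<^sup>p\<close>, \<open>p = b / 2\<close>, in which the first-order terms cancel: it is at most a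
  multiple of \<open>\<bar>v\<bar>\<^sup>2 (1 + \<bar>v\<bar>\<^sup>2)\<^sup>q (1 + \<bar>u\<bar>\<^sup>2)\<^sup>p\<close>, \<open>q = \<bar>p\<bar>\<close>, by Taylor's formula when \<open>v\<close> is small
  compared to \<open>(1 + \<bar>u\<bar>\<^sup>2)\<^sup>1\<^sup>/\<^sup>2\<close> and by Peetre's inequality otherwise. The factor \<open>\<bar>v\<bar>\<^sup>2 = \<bar>z\<bar>\<^sup>2 / \<eta>\<close>
  gives the gain \<open>1 / \<eta>\<close>.\<close>

section \<open>Taylor estimate for real powers and Peetre's inequality\<close>

lemma powr_bounded_near_one:
  fixes x a :: real
  assumes "1/4 \<le> x" "x \<le> 4"
  shows "x powr a \<le> 4 powr \<bar>a\<bar>"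
proof (cases "a \<ge> 0")
  case True
  then show ?thesis using assms by (simp add: powr_mono2)
next
  case False
  have "x powr a \<le> (1/4) powr a"
    using assms False by (intro powr_mono2') auto
  also have "\<dots> = 4 powr \<bar>a\<bar>"
    using False by (simp add: powr_divide powr_minus_divide)
  finally show ?thesis .
qed

text \<open>Second-order Taylor expansion at 0: the remainder contains (1 + s)^(p - 2) with s
  between 0 and t. The restriction on t keeps 1 + s in [1/4, 4], where this power is at most
  \<open>4 powr \<bar>p - 2\<bar>\<close>. The factor 1/2 of the remainder is discarded.\<close>

lemma powr_linear_approx:
  fixes p t :: real
  assumes "\<bar>t\<bar> \<le> 3/4"
  shows "\<bar>(1 + t) powr p - 1 - p * t\<bar> \<le> \<bar>p * (p - 1)\<bar> * 4 powr \<bar>p - 2\<bar> * t\<^sup>2"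
\<comment> \<open>\<open>Taylor\<close> requires the point of evaluation to differ from the
  centre.\<close>
proof (cases "t = 0")
  case False
  \<comment> \<open>The expansion stops at order 2, so the values of \<open>diff\<close> beyond that
    order are arbitrary.\<close>
  define diff where "diff m x =
    (if m = 0 then (1 + x) powr p else if m = Suc 0 then p * (1 + x) powr (p - 1)
     else p * (p - 1) * (1 + x) powr (p - 2))" for m :: nat and x :: real
  have base: "((\<lambda>x. (1 + x) powr q) has_real_derivative q * (1 + x) powr (q - 1)) (at x)"
    if "-3/4 \<le> x" for q x :: real
    using DERIV_fun_powr[of "\<lambda>x. 1 + x" 1 x q] that by (auto intro!: derivative_eq_intros)
  have der: "(diff m has_real_derivative diff (Suc m) x) (at x)"
    if "m < 2" "-3/4 \<le> x" for m x
    using that base[of x p] DERIV_cmult[OF base[of x "p - 1"], of p]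
    unfolding diff_def less_2_cases_iff by (auto simp: mult.assoc)
  have "\<exists>s. (if t < 0 then t < s \<and> s < 0 else 0 < s \<and> s < t) \<and>
      (1 + t) powr p = (\<Sum>m<2. diff m 0 / fact m * (t - 0) ^ m) + diff 2 s / fact 2 * (t - 0) ^ 2"
    using False assms der
    by (intro Taylor[where f = "\<lambda>x. (1 + x) powr p" and a = "-3/4" and b = "3/4"])
       (auto simp: diff_def[of 0])
  then obtain s where s: "if t < 0 then t < s \<and> s < 0 else 0 < s \<and> s < t"
    and eq: "(1 + t) powr p = (\<Sum>m<2. diff m 0 / fact m * (t - 0) ^ m) + diff 2 s / fact 2 * (t - 0) ^ 2"
    by blast
  have "\<bar>(1 + t) powr p - 1 - p * t\<bar> = \<bar>p * (p - 1)\<bar> * (1 + s) powr (p - 2) / 2 * t\<^sup>2"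
    by (simp add: eq diff_def numeral_2_eq_2 abs_mult)
  also have "\<dots> \<le> \<bar>p * (p - 1)\<bar> * 4 powr \<bar>p - 2\<bar> * t\<^sup>2"
  proof (intro mult_right_mono)
    have "(1 + s) powr (p - 2) \<le> 4 powr \<bar>p - 2\<bar>"
      using s assms by (intro powr_bounded_near_one) (auto split: if_splits)
    then have "\<bar>p * (p - 1)\<bar> * (1 + s) powr (p - 2) \<le> \<bar>p * (p - 1)\<bar> * 4 powr \<bar>p - 2\<bar>"
      by (rule mult_left_mono) simp
    moreover have "0 \<le> \<bar>p * (p - 1)\<bar> * (1 + s) powr (p - 2)" by simp
    ultimately show "\<bar>p * (p - 1)\<bar> * (1 + s) powr (p - 2) / 2 \<le> \<bar>p * (p - 1)\<bar> * 4 powr \<bar>p - 2\<bar>"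
      by linarith
  qed simp
  finally show ?thesis .
qed simp

text \<open>By the parallelogram law |u + v|^2 is at most 2|u|^2 + 2|v|^2; both terms occur in the
  expanded right-hand side, whose other terms are nonnegative and include the constant 2.\<close>

lemma Peetre_inequality:
  fixes u v :: "'a::real_inner"
  shows "1 + (norm (u + v))\<^sup>2 \<le> 2 * (1 + (norm u)\<^sup>2) * (1 + (norm v)\<^sup>2)"
proof -
  have "(norm (u + v))\<^sup>2 + (norm (u - v))\<^sup>2 = 2 * (norm u)\<^sup>2 + 2 * (norm v)\<^sup>2"
    by (simp add: power2_norm_eq_inner algebra_simps inner_commute)
  moreover have "2 * (1 + (norm u)\<^sup>2) * (1 + (norm v)\<^sup>2)
      = 2 + 2 * (norm u)\<^sup>2 + 2 * (norm v)\<^sup>2 + 2 * (norm u * norm v)\<^sup>2"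
    by (simp add: power_mult_distrib algebra_simps)
  ultimately show ?thesis
    using zero_le_power2[of "norm (u - v)"] zero_le_power2[of "norm u * norm v"] by linarith
qed

lemma Peetre_inequality_powr:
  fixes u v :: "'a::real_inner"
  shows "(1 + (norm (u + v))\<^sup>2) powr p
    \<le> 2 powr \<bar>p\<bar> * (1 + (norm v)\<^sup>2) powr \<bar>p\<bar> * (1 + (norm u)\<^sup>2) powr p"
proof -
  define X Y Z where "X = 1 + (norm u)\<^sup>2" and "Y = 1 + (norm v)\<^sup>2" and "Z = 1 + (norm (u + v))\<^sup>2"
  have pos: "X > 0" "Y > 0" "Z > 0"
    by (simp_all add: X_def Y_def Z_def add_pos_nonneg)
  have "Z powr p \<le> 2 powr \<bar>p\<bar> * Y powr \<bar>p\<bar> * X powr p"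
  proof (cases "p \<ge> 0")
    case True
    have "Z powr p \<le> (2 * X * Y) powr p"
      using True pos Peetre_inequality[of u v] by (intro powr_mono2) (auto simp: X_def Y_def Z_def)
    also have "\<dots> = 2 powr \<bar>p\<bar> * Y powr \<bar>p\<bar> * X powr p"
      using True pos by (simp add: powr_mult)
    finally show ?thesis .
  next
    case False
    \<comment> \<open>For p < 0 a lower bound on \<open>Z\<close> is required. It comes from writing
      u = (u + v) + (-v), which exchanges the roles of \<open>X\<close> and
      \<open>Z\<close>.\<close>
    have "X \<le> 2 * Z * Y"
      using Peetre_inequality[of "u + v" "- v"] by (simp add: X_def Y_def Z_def)
    then have "(2 * Z * Y) powr p \<le> X powr p"
      using False pos by (intro powr_mono2') auto
    then have "Z powr p * (2 powr p * Y powr p) \<le> X powr p"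
      using pos by (simp add: powr_mult mult_ac)
    then have "Z powr p \<le> X powr p / (2 powr p * Y powr p)"
      using pos by (subst pos_le_divide_eq) auto
    also have "\<dots> = 2 powr \<bar>p\<bar> * Y powr \<bar>p\<bar> * X powr p"
      using False by (simp add: powr_minus_divide)
    finally show ?thesis .
  qed
  then show ?thesis by (simp only: X_def Y_def Z_def)
qed

section \<open>Second differences of (1 + |u|^2)^p\<close>

lemma second_difference_bound:
  fixes p :: real
  obtains C where "C \<ge> 0" and
    "\<And>u v :: 'a::real_inner. \<bar>(1 + (norm (u + v))\<^sup>2) powr p + (1 + (norm (u - v))\<^sup>2) powr p
        - 2 * (1 + (norm u)\<^sup>2) powr p\<bar>
      \<le> C * (norm v)\<^sup>2 * (1 + (norm v)\<^sup>2) powr \<bar>p\<bar> * (1 + (norm u)\<^sup>2) powr p"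
proof -
  define K where "K = \<bar>p * (p - 1)\<bar> * 4 powr \<bar>p - 2\<bar>"
  \<comment> \<open>The first two summands serve small v: what survives of the linear terms, and two
    Taylor errors of size 6K. The last serves large v: two Peetre bounds and the term -2 (1 +
    |u|^2)^p, times 16. Their sum covers both cases.\<close>
  define C where "C = 2 * \<bar>p\<bar> + 12 * K + 32 * (2 powr \<bar>p\<bar> + 1)"
  have K0: "K \<ge> 0" by (simp add: K_def)
  have "\<bar>(1 + (norm (u + v))\<^sup>2) powr p + (1 + (norm (u - v))\<^sup>2) powr p
        - 2 * (1 + (norm u)\<^sup>2) powr p\<bar>
      \<le> C * (norm v)\<^sup>2 * (1 + (norm v)\<^sup>2) powr \<bar>p\<bar> * (1 + (norm u)\<^sup>2) powr p"
    for u v :: 'a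
  proof -
    define A where "A = 1 + (norm u)\<^sup>2"
    define B where "B = (1 + (norm v)\<^sup>2) powr \<bar>p\<bar>"
    have A1: "A \<ge> 1" by (simp add: A_def)
    have B1: "B \<ge> 1" by (simp add: B_def ge_one_powr_ge_zero)
    have Ap: "A powr p > 0" using A1 by simp
    show ?thesis
    \<comment> \<open>Below the threshold |v| is at most sqrt A / 4, so the relative increment
      \<open>t\<close> defined below satisfies |t| <= 9/16, within the range of
      \<open>powr_linear_approx\<close>.\<close>
    proof (cases "(norm v)\<^sup>2 \<le> A / 16")
      case True
      have nv: "norm v \<le> sqrt A / 4"
        using real_sqrt_le_mono[OF True] by (simp add: real_sqrt_divide)
      have abs_add_le: "\<bar>a\<bar> \<le> y + x" if "\<bar>a - q\<bar> \<le> x" "\<bar>q\<bar> \<le> y" for a q x y :: real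
        using that by linarith
      \<comment> \<open>With t = (2 u.w + |w|^2) / A one has 1 + |u + w|^2 = A (1 + t), so this is
        the linear approximation of (1 + t)^p scaled by A^p. Only the norm of \<open>w\<close> is
        prescribed, so that both v and -v qualify.\<close>
      have expand: "\<bar>(1 + (norm (u + w))\<^sup>2) powr p - A powr p * (1 + p * ((2 * (u \<bullet> w) + (norm v)\<^sup>2) / A))\<bar>
        \<le> A powr p * (6 * K * (norm v)\<^sup>2)" if w: "norm w = norm v" for w
      proof -
        define t where "t = (2 * (u \<bullet> w) + (norm v)\<^sup>2) / A"
        have "\<bar>u \<bullet> w\<bar> \<le> norm u * norm v" using Cauchy_Schwarz_ineq2[of u w] w by simp
        also have "\<dots> \<le> sqrt A * norm v"
          by (intro mult_right_mono real_le_rsqrt) (auto simp: A_def)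
        finally have uw: "\<bar>u \<bullet> w\<bar> \<le> sqrt A * norm v" .
        have "(norm v)\<^sup>2 \<le> sqrt A / 4 * norm v"
          unfolding power2_eq_square using nv by (intro mult_right_mono) auto
        moreover have tA_eq: "t * A = 2 * (u \<bullet> w) + (norm v)\<^sup>2" using A1 by (simp add: t_def)
        ultimately have tA: "\<bar>t * A\<bar> \<le> 9/4 * (sqrt A * norm v)"
          using uw zero_le_power2[of "norm v"] by linarith
        have "sqrt A * norm v \<le> sqrt A * (sqrt A / 4)"
          using nv A1 by (intro mult_left_mono) auto
        also have "\<dots> = A / 4" using A1 by simp
        finally have "\<bar>t * A\<bar> \<le> 9/16 * A" using tA by linarith
        then have t: "\<bar>t\<bar> \<le> 3/4" using A1 by (simp add: abs_mult)
        have "(t * A)\<^sup>2 \<le> (9/4 * (sqrt A * norm v))\<^sup>2"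
          using power_mono[OF tA, of 2] by simp
        \<comment> \<open>Here (9/4)^2 = 81/16 < 6. Next, A <= A^2 allows division by A^2 to leave a
          bound on t^2 by |v|^2 alone.\<close>
        also have "\<dots> \<le> 6 * A * (norm v)\<^sup>2"
          using A1 by (simp add: power_mult_distrib) (simp add: field_simps)
        also have "\<dots> \<le> 6 * A\<^sup>2 * (norm v)\<^sup>2"
          using A1 by (intro mult_right_mono) (auto simp: power2_eq_square)
        finally have t2: "t\<^sup>2 \<le> 6 * (norm v)\<^sup>2" using A1 by (simp add: power_mult_distrib field_simps)
        have "1 + (norm (u + w))\<^sup>2 = A * (1 + t)"
          unfolding distrib_left mult.commute[of A t] tA_eq
          by (simp add: A_def w[symmetric] power2_norm_eq_inner algebra_simps inner_commute)
        then have "(1 + (norm (u + w))\<^sup>2) powr p = A powr p * (1 + t) powr p"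
          using A1 t by (simp add: powr_mult)
        then have "\<bar>(1 + (norm (u + w))\<^sup>2) powr p - A powr p * (1 + p * t)\<bar>
            = A powr p * \<bar>(1 + t) powr p - 1 - p * t\<bar>"
          by (subst abs_of_pos[OF Ap, symmetric], subst abs_mult[symmetric]) (simp add: algebra_simps)
        also have "\<dots> \<le> A powr p * (6 * K * (norm v)\<^sup>2)"
        proof (intro mult_left_mono)
          have "\<bar>(1 + t) powr p - 1 - p * t\<bar> \<le> K * t\<^sup>2"
            using powr_linear_approx[OF t] by (simp add: K_def)
          also have "\<dots> \<le> K * (6 * (norm v)\<^sup>2)" using t2 K0 by (rule mult_left_mono)
          finally show "\<bar>(1 + t) powr p - 1 - p * t\<bar> \<le> 6 * K * (norm v)\<^sup>2" by simp
        qed (use Ap in simp)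
        finally show ?thesis by (simp add: t_def)
      qed
      have "\<bar>(1 + (norm (u + v))\<^sup>2) powr p + (1 + (norm (u - v))\<^sup>2) powr p - 2 * A powr p
          - A powr p * (2 * p * (norm v)\<^sup>2 / A)\<bar> \<le> 2 * (A powr p * (6 * K * (norm v)\<^sup>2))"
      proof -
        \<comment> \<open>The inner products for v and -v cancel; without this the bound would be of
          first order in |v|.\<close>
        have "A powr p * (1 + p * ((2 * (u \<bullet> v) + (norm v)\<^sup>2) / A))
            + A powr p * (1 + p * ((2 * (u \<bullet> - v) + (norm v)\<^sup>2) / A))
            = 2 * A powr p + A powr p * (2 * p * (norm v)\<^sup>2 / A)"
          using A1 by (simp add: field_simps)
        moreover have "\<bar>a + a' - m - q\<bar> \<le> 2 * e"
          if "\<bar>a - c\<bar> \<le> e" "\<bar>a' - c'\<bar> \<le> e" "c + c' = m + q" for a a' c c' m q e :: real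
          using that by linarith
        ultimately show ?thesis
          using expand[of v, OF refl] expand[of "- v", OF norm_minus_cancel]
          unfolding add_uminus_conv_diff by blast
      qed
      moreover have "\<bar>A powr p * (2 * p * (norm v)\<^sup>2 / A)\<bar> \<le> A powr p * (2 * \<bar>p\<bar> * (norm v)\<^sup>2)"
      proof -
        have "2 * \<bar>p\<bar> * (norm v)\<^sup>2 / A \<le> 2 * \<bar>p\<bar> * (norm v)\<^sup>2 / 1"
          using A1 by (intro divide_left_mono) auto
        then have "A powr p * (2 * \<bar>p\<bar> * (norm v)\<^sup>2 / A) \<le> A powr p * (2 * \<bar>p\<bar> * (norm v)\<^sup>2)"
          using Ap by (intro mult_left_mono) auto
        then show ?thesis using A1 Ap by (simp add: abs_mult)
      qed
      ultimately have "\<bar>(1 + (norm (u + v))\<^sup>2) powr p + (1 + (norm (u - v))\<^sup>2) powr p - 2 * A powr p\<bar>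
          \<le> A powr p * (2 * \<bar>p\<bar> * (norm v)\<^sup>2) + 2 * (A powr p * (6 * K * (norm v)\<^sup>2))"
        by (rule abs_add_le)
      also have "\<dots> = (2 * \<bar>p\<bar> + 12 * K) * (norm v)\<^sup>2 * 1 * A powr p"
        by (simp add: algebra_simps)
      also have "\<dots> \<le> C * (norm v)\<^sup>2 * B * A powr p"
        using B1 Ap K0 by (intro mult_mono) (auto simp: C_def)
      finally show ?thesis by (simp add: A_def B_def)
    next
      case False
      \<comment> \<open>For large v no cancellation is sought: each term is bounded separately, and
        the factor |v|^2 is inserted at the cost of 16.\<close>
      then have v: "16 * (norm v)\<^sup>2 \<ge> 1" using A1 by simp
      have P: "(1 + (norm (u + v))\<^sup>2) powr p \<le> 2 powr \<bar>p\<bar> * B * A powr p"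
        "(1 + (norm (u - v))\<^sup>2) powr p \<le> 2 powr \<bar>p\<bar> * B * A powr p"
        using Peetre_inequality_powr[of u v p] Peetre_inequality_powr[of u "-v" p]
        by (simp_all add: A_def B_def)
      have "A powr p \<le> B * A powr p" using B1 Ap by simp
      moreover have "\<bar>a + a' - 2 * c\<bar> \<le> 2 * x + 2 * y"
        if "a \<le> x" "a' \<le> x" "c \<le> y" "0 \<le> a" "0 \<le> a'" "0 \<le> c" for a a' c x y :: real
        using that by linarith
      ultimately have "\<bar>(1 + (norm (u + v))\<^sup>2) powr p + (1 + (norm (u - v))\<^sup>2) powr p - 2 * A powr p\<bar>
          \<le> 2 * (2 powr \<bar>p\<bar> * B * A powr p) + 2 * (B * A powr p)"
        using P Ap by simp
      also have "\<dots> = 2 * (2 powr \<bar>p\<bar> + 1) * 1 * B * A powr p" by (simp add: algebra_simps)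
      also have "\<dots> \<le> 2 * (2 powr \<bar>p\<bar> + 1) * (16 * (norm v)\<^sup>2) * B * A powr p"
        using v B1 by (intro mult_right_mono mult_left_mono) auto
      also have "\<dots> = 32 * (2 powr \<bar>p\<bar> + 1) * (norm v)\<^sup>2 * B * A powr p" by simp
      also have "\<dots> \<le> C * (norm v)\<^sup>2 * B * A powr p"
        using B1 K0 by (intro mult_right_mono) (auto simp: C_def)
      finally show ?thesis by (simp add: A_def B_def)
    qed
  qed
  moreover have "C \<ge> 0" using K0 by (simp add: C_def)
  ultimately show ?thesis using that by blast
qed

section \<open>Invariance of Lebesgue measure under y -> x - y\<close>

lemma lebesgue_reflection:
  fixes x :: "'a::euclidean_space"
  shows "(\<lambda>y. x - y) \<in> lebesgue \<rightarrow>\<^sub>M lebesgue"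
    and "distr lebesgue lebesgue (\<lambda>y. x - y) = lebesgue"
proof -
  \<comment> \<open>The reflection is written as a coordinatewise affine map with all factors -1,
    whose determinant has absolute value 1.\<close>
  have T: "(\<lambda>y. x + (\<Sum>j\<in>Basis. (-1 * (y \<bullet> j)) *\<^sub>R j)) = (\<lambda>y. x - y)"
    by (simp add: fun_eq_iff sum_negf euclidean_representation)
  show "(\<lambda>y. x - y) \<in> lebesgue \<rightarrow>\<^sub>M lebesgue"
    using lebesgue_affine_measurable[of "\<lambda>_. -1" x] unfolding T by simp
  show "distr lebesgue lebesgue (\<lambda>y. x - y) = lebesgue"
    using lebesgue_affine_euclidean[of "\<lambda>_. -1" x] unfolding T by (simp add: density_1)
qed

lemma integrable_lebesgue_reflection_iff:
  fixes x :: "'a::euclidean_space" and f :: "'a \<Rightarrow> real"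
  shows "integrable lebesgue (\<lambda>y. f (x - y)) \<longleftrightarrow> integrable lebesgue f"
proof -
  have *: "integrable lebesgue (\<lambda>y. g (x - y))" if "integrable lebesgue g" for g :: "'a \<Rightarrow> real"
    using integrable_distr[OF lebesgue_reflection(1)[of x], of g] that
    by (simp add: lebesgue_reflection(2))
  show ?thesis
    \<comment> \<open>The reflection is an involution, so the same implication gives the
      converse.\<close>
    using *[of f] *[of "\<lambda>y. f (x - y)"] by auto
qed

lemma integral_lebesgue_reflection:
  fixes x :: "'a::euclidean_space" and f :: "'a \<Rightarrow> real"
  assumes "f \<in> borel_measurable lebesgue"
  shows "(LINT y|lebesgue. f (x - y)) = (LINT y|lebesgue. f y)"
  using integral_distr[OF lebesgue_reflection(1)[of x] assms]
  by (simp add: lebesgue_reflection(2))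

section \<open>Brackets, weighted spaces and integrability of the convolution\<close>

lemma japanese_bracket_ge_1: "japanese_bracket x \<ge> 1"
  by (simp add: japanese_bracket_def)

lemma japanese_bracket_powr: "japanese_bracket x powr a = (1 + (norm x)\<^sup>2) powr (a / 2)"
  by (simp add: japanese_bracket_def powr_half_sqrt[symmetric] powr_powr)

lemma scaled_bracket_pos: "\<eta> \<ge> 0 \<Longrightarrow> scaled_bracket \<eta> x > 0"
  by (simp add: scaled_bracket_def add_pos_nonneg)

lemma norm_scaleR_inverse_sqrt:
  fixes x :: "'a::real_normed_vector"
  assumes "\<eta> \<ge> 0"
  shows "(norm (x /\<^sub>R sqrt \<eta>))\<^sup>2 = (norm x)\<^sup>2 / \<eta>"
proof -
  have "norm (x /\<^sub>R sqrt \<eta>) = norm x / sqrt \<eta>"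
    using assms by (simp add: divide_inverse_commute)
  then show ?thesis
    using assms by (simp add: power_divide)
qed

text \<open>Moving \<eta> into the argument makes the estimates for (1 + |u|^2)^p, p = b / 2,
  available with constants free of \<eta>.\<close>

lemma scaled_bracket_powr:
  assumes "\<eta> \<ge> 0"
  shows "scaled_bracket \<eta> x powr b = (1 + (norm (x /\<^sub>R sqrt \<eta>))\<^sup>2) powr (b / 2)"
  unfolding norm_scaleR_inverse_sqrt[OF assms]
  by (simp add: scaled_bracket_def powr_half_sqrt[symmetric] powr_powr assms)

lemma scaled_bracket_measurable:
  "(\<lambda>x :: real ^ 'n. scaled_bracket \<eta> x powr b) \<in> borel_measurable lebesgue"
proof -
  have "(\<lambda>x :: real ^ 'n. scaled_bracket \<eta> x powr b) \<in> borel_measurable borel"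
    unfolding scaled_bracket_def by measurable
  then show ?thesis by (simp add: measurable_completion)
qed

text \<open>The bracket is at least 1, so its powers increase with the exponent. This brings the
  given decay down to the exponents 2 + |b|, |b| and 0.\<close>

lemma weighted_L1_mono:
  assumes J: "J \<in> weighted_L1 a" and "c \<le> a"
  shows "J \<in> weighted_L1 c"
proof -
  have meas: "J \<in> borel_measurable lebesgue"
    and int: "integrable lebesgue (\<lambda>x. japanese_bracket x powr a * J x)"
    using J by (auto simp: weighted_L1_def)
  have "(\<lambda>x :: real ^ 'a. japanese_bracket x powr c) \<in> borel_measurable borel"
    unfolding japanese_bracket_def by measurable
  then have "(\<lambda>x :: real ^ 'a. japanese_bracket x powr c) \<in> borel_measurable lebesgue"
    by (simp add: measurable_completion)
  then have "integrable lebesgue (\<lambda>x. japanese_bracket x powr c * J x)"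
    using meas assms(2) japanese_bracket_ge_1
    by (intro Bochner_Integration.integrable_bound[OF int] borel_measurable_times always_eventually allI)
       (auto simp: abs_mult intro!: mult_right_mono powr_mono)
  with meas show ?thesis by (simp add: weighted_L1_def)
qed

lemma weighted_L1_0_integrable:
  assumes "J \<in> weighted_L1 0"
  shows "integrable lebesgue (\<lambda>x. \<bar>J x\<bar>)"
proof -
  \<comment> \<open>Since \<open>0 powr 0 = 0\<close>, the base must be known to be nonzero.\<close>
  have "japanese_bracket x powr 0 = 1" for x :: "real ^ 'a"
    using japanese_bracket_ge_1[of x] by simp
  then show ?thesis
    using assms by (simp add: weighted_L1_def)
qed

text \<open>Peetre's inequality splits the weight at x - z into a constant depending on x and a
  weight in z; the latter is at most a multiple of <z>^|b| because |z|^2 / \<eta> <= |z|^2.\<close>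

lemma integrable_convolution_scaled_bracket:
  fixes J :: "real ^ 'n \<Rightarrow> real"
  assumes J: "J \<in> weighted_L1 \<bar>b\<bar>" and \<eta>: "\<eta> \<ge> 1"
  shows "integrable lebesgue (\<lambda>z. \<bar>J z\<bar> * scaled_bracket \<eta> (x - z) powr b)"
proof -
  have meas: "J \<in> borel_measurable lebesgue"
    and int: "integrable lebesgue (\<lambda>z. japanese_bracket z powr \<bar>b\<bar> * J z)"
    using J by (auto simp: weighted_L1_def)
  let ?c = "2 powr (\<bar>b\<bar> / 2) * scaled_bracket \<eta> x powr b"
  have bound: "scaled_bracket \<eta> (x - z) powr b \<le> ?c * japanese_bracket z powr \<bar>b\<bar>" for z
  proof -
    have "(norm (z /\<^sub>R sqrt \<eta>))\<^sup>2 \<le> (norm z)\<^sup>2"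
      using \<eta> norm_scaleR_inverse_sqrt[of \<eta> z] by (simp add: divide_le_eq mult_le_cancel_left1)
    then have "(1 + (norm (z /\<^sub>R sqrt \<eta>))\<^sup>2) powr (\<bar>b\<bar> / 2) \<le> (1 + (norm z)\<^sup>2) powr (\<bar>b\<bar> / 2)"
      by (intro powr_mono2) auto
    then have le: "2 powr (\<bar>b\<bar> / 2) * (1 + (norm (z /\<^sub>R sqrt \<eta>))\<^sup>2) powr (\<bar>b\<bar> / 2) * scaled_bracket \<eta> x powr b
        \<le> 2 powr (\<bar>b\<bar> / 2) * (1 + (norm z)\<^sup>2) powr (\<bar>b\<bar> / 2) * scaled_bracket \<eta> x powr b"
      by (intro mult_right_mono mult_left_mono) auto
    have "scaled_bracket \<eta> (x - z) powr b \<le> 2 powr \<bar>b / 2\<bar> *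
        (1 + (norm (- (z /\<^sub>R sqrt \<eta>)))\<^sup>2) powr \<bar>b / 2\<bar> * scaled_bracket \<eta> x powr b"
      using Peetre_inequality_powr[of "x /\<^sub>R sqrt \<eta>" "- (z /\<^sub>R sqrt \<eta>)" "b / 2"] \<eta>
      unfolding scaled_bracket_powr[OF order_trans[OF zero_le_one \<eta>]]
      by (simp only: scaleR_diff_right add_uminus_conv_diff)
    also have "\<dots> = 2 powr (\<bar>b\<bar> / 2) * (1 + (norm (z /\<^sub>R sqrt \<eta>))\<^sup>2) powr (\<bar>b\<bar> / 2) * scaled_bracket \<eta> x powr b"
      by simp
    also note le
    finally show ?thesis by (simp add: japanese_bracket_powr mult_ac)
  qed
  have m: "(\<lambda>z. scaled_bracket \<eta> (x - z) powr b) \<in> borel_measurable lebesgue"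
    using measurable_compose[OF lebesgue_reflection(1) scaled_bracket_measurable] .
  show ?thesis
  proof (rule Bochner_Integration.integrable_bound[OF integrable_mult_right[OF int, of ?c]])
    show "(\<lambda>z. \<bar>J z\<bar> * scaled_bracket \<eta> (x - z) powr b) \<in> borel_measurable lebesgue"
      using meas m by (intro borel_measurable_times borel_measurable_abs)
    show "AE z in lebesgue. norm (\<bar>J z\<bar> * scaled_bracket \<eta> (x - z) powr b)
        \<le> norm (?c * (japanese_bracket z powr \<bar>b\<bar> * J z))"
    proof (intro always_eventually allI)
      fix z
      show "norm (\<bar>J z\<bar> * scaled_bracket \<eta> (x - z) powr b) \<le> norm (?c * (japanese_bracket z powr \<bar>b\<bar> * J z))"
        using mult_left_mono[OF bound[of z] abs_ge_zero[of "J z"]] by (simp add: abs_mult mult_ac)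
    qed
  qed
qed

section \<open>The convolution estimate\<close>

lemma convolution_estimate_mono:
  assumes "convolution_estimate J b d" "d \<le> d'"
  shows "convolution_estimate J b d'"
  unfolding convolution_estimate_def
proof (intro allI impI conjI)
  fix \<eta> x assume \<eta>: "2 \<le> (\<eta>::real)"
  show "integrable lebesgue (\<lambda>y. \<bar>J (x - y)\<bar> * scaled_bracket \<eta> y powr b)"
    using assms(1) \<eta> by (simp add: convolution_estimate_def)
  have "d / \<eta> * scaled_bracket \<eta> x powr b \<le> d' / \<eta> * scaled_bracket \<eta> x powr b"
    using assms(2) \<eta> by (intro mult_right_mono divide_right_mono) auto
  then show "\<bar>(LINT y|lebesgue. \<bar>J (x - y)\<bar> * scaled_bracket \<eta> y powr b)
      - L1_norm J * scaled_bracket \<eta> x powr b\<bar> \<le> d' / \<eta> * scaled_bracket \<eta> x powr b"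
    using assms(1) \<eta> unfolding convolution_estimate_def by (meson order_trans)
qed

text \<open>The constant is the one from \<open>second_difference_bound\<close> at exponent b / 2,
  hence chosen before \<open>J\<close>, \<eta> and x.\<close>

lemma convolution_estimate_radial:
  fixes b :: real
  obtains C where "C \<ge> 0" and "\<And>J :: real ^ 'n \<Rightarrow> real.
    J \<in> weighted_L1 (2 + \<bar>b\<bar>) \<Longrightarrow> radially_symmetric J \<Longrightarrow>
      convolution_estimate J b (C * weighted_L1_norm (2 + \<bar>b\<bar>) J)"
proof -
  obtain C where C0: "C \<ge> 0" and
    C: "\<And>u v :: real ^ 'n. \<bar>(1 + (norm (u + v))\<^sup>2) powr (b/2) + (1 + (norm (u - v))\<^sup>2) powr (b/2)
        - 2 * (1 + (norm u)\<^sup>2) powr (b/2)\<bar>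
      \<le> C * (norm v)\<^sup>2 * (1 + (norm v)\<^sup>2) powr \<bar>b/2\<bar> * (1 + (norm u)\<^sup>2) powr (b/2)"
    using second_difference_bound[where 'a = "real ^ 'n" and p = "b / 2"] by blast
  have "convolution_estimate J b (C * weighted_L1_norm (2 + \<bar>b\<bar>) J)"
    if J: "J \<in> weighted_L1 (2 + \<bar>b\<bar>)" and rad: "radially_symmetric J" for J :: "real ^ 'n \<Rightarrow> real"
    unfolding convolution_estimate_def
  proof (intro allI impI)
    fix \<eta> :: real and x :: "real ^ 'n" assume \<eta>: "2 \<le> \<eta>"
    define L where "L z = scaled_bracket \<eta> z powr b" for z :: "real ^ 'n"
    define W where "W z = \<bar>japanese_bracket z powr (2 + \<bar>b\<bar>) * J z\<bar>" for z
    have W: "integrable lebesgue W"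
      using J unfolding W_def weighted_L1_def by (intro integrable_abs) simp
    have Jb: "J \<in> weighted_L1 \<bar>b\<bar>" "J \<in> weighted_L1 0"
      by (rule weighted_L1_mono[OF J], simp)+
    then have J1: "integrable lebesgue (\<lambda>z. \<bar>J z\<bar>)"
      using weighted_L1_0_integrable by blast
    have int: "integrable lebesgue (\<lambda>z. \<bar>J z\<bar> * L (x - z))"
      unfolding L_def using integrable_convolution_scaled_bracket[OF Jb(1)] \<eta> by simp
    \<comment> \<open>Radial symmetry enters as evenness: reflecting z at the origin turns L (x - z)
      into L (x + z), so the convolution has two equal representations, whose sum produces the
      second difference.\<close>
    have even: "J (- z) = J z" for z
      using rad norm_minus_cancel[of z] unfolding radially_symmetric_def by blast
    have int': "integrable lebesgue (\<lambda>z. \<bar>J z\<bar> * L (x + z))"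
      using int integrable_lebesgue_reflection_iff[of "\<lambda>z. \<bar>J z\<bar> * L (x - z)" 0]
      by (simp add: even)
    have eq': "(LINT z|lebesgue. \<bar>J z\<bar> * L (x + z)) = (LINT z|lebesgue. \<bar>J z\<bar> * L (x - z))"
      using integral_lebesgue_reflection[OF borel_measurable_integrable[OF int], of 0]
      by (simp add: even)
    have conv_int: "integrable lebesgue (\<lambda>y. \<bar>J (x - y)\<bar> * L y)"
      using int integrable_lebesgue_reflection_iff[of "\<lambda>z. \<bar>J z\<bar> * L (x - z)" x] by simp
    have conv_eq: "(LINT y|lebesgue. \<bar>J (x - y)\<bar> * L y) = (LINT z|lebesgue. \<bar>J z\<bar> * L (x - z))"
      using integral_lebesgue_reflection[OF borel_measurable_integrable[OF int], of x] by simp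
    have pointwise: "\<bar>\<bar>J z\<bar> * L (x + z) + \<bar>J z\<bar> * L (x - z) - 2 * (\<bar>J z\<bar> * L x)\<bar>
        \<le> C / \<eta> * L x * W z" for z
    proof -
      have n: "(norm (z /\<^sub>R sqrt \<eta>))\<^sup>2 = (norm z)\<^sup>2 / \<eta>"
        using norm_scaleR_inverse_sqrt[of \<eta> z] \<eta> by simp
      have le: "(norm z)\<^sup>2 / \<eta> \<le> (norm z)\<^sup>2"
        using \<eta> by (simp add: divide_le_eq mult_le_cancel_left1)
      have "\<bar>L (x + z) + L (x - z) - 2 * L x\<bar>
          \<le> C * ((norm z)\<^sup>2 / \<eta>) * (1 + (norm z)\<^sup>2 / \<eta>) powr \<bar>b/2\<bar> * L x"
        using C[of "x /\<^sub>R sqrt \<eta>" "z /\<^sub>R sqrt \<eta>"] \<eta>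
        unfolding n scaleR_add_right[symmetric] scaleR_diff_right[symmetric]
        by (simp add: L_def scaled_bracket_powr)
      \<comment> \<open>The first factor keeps the gain 1 / \<eta>, while \<eta> is dropped inside
        the power. The two powers of 1 + |z|^2 then combine to the weight <z>^(2 + |b|).\<close>
      also have "\<dots> \<le> C * ((1 + (norm z)\<^sup>2) / \<eta>) * (1 + (norm z)\<^sup>2) powr \<bar>b/2\<bar> * L x"
        using C0 \<eta> le
        by (intro mult_right_mono mult_mono mult_left_mono divide_right_mono powr_mono2)
           (auto simp: L_def)
      also have "\<dots> = C / \<eta> * L x * japanese_bracket z powr (2 + \<bar>b\<bar>)"
      proof -
        have "(2 + \<bar>b\<bar>) / 2 = 1 + \<bar>b/2\<bar>" by simp
        then show ?thesis
          unfolding japanese_bracket_powr by (simp only: powr_add) (simp add: add_nonneg_nonneg)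
      qed
      finally have "\<bar>J z\<bar> * \<bar>L (x + z) + L (x - z) - 2 * L x\<bar>
          \<le> \<bar>J z\<bar> * (C / \<eta> * L x * japanese_bracket z powr (2 + \<bar>b\<bar>))"
        by (rule mult_left_mono) simp
      moreover have "\<bar>J z\<bar> * \<bar>L (x + z) + L (x - z) - 2 * L x\<bar>
        = \<bar>\<bar>J z\<bar> * L (x + z) + \<bar>J z\<bar> * L (x - z) - 2 * (\<bar>J z\<bar> * L x)\<bar>"
        by (subst abs_abs[of "J z", symmetric], subst abs_mult[symmetric]) (simp add: algebra_simps)
      ultimately show ?thesis by (simp add: W_def abs_mult mult_ac)
    qed
    have "2 * ((LINT y|lebesgue. \<bar>J (x - y)\<bar> * L y) - L1_norm J * L x)
        = (LINT z|lebesgue. \<bar>J z\<bar> * L (x + z) + \<bar>J z\<bar> * L (x - z) - 2 * (\<bar>J z\<bar> * L x))"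
      using int int' J1 by (simp add: conv_eq eq' L1_norm_def)
    also have "\<bar>\<dots>\<bar> \<le> (LINT z|lebesgue. C / \<eta> * L x * W z)"
      using int int' J1 W pointwise
      by (intro order_trans[OF integral_abs_bound] integral_mono) auto
    also have "\<dots> = C * weighted_L1_norm (2 + \<bar>b\<bar>) J / \<eta> * L x"
      by (simp add: weighted_L1_norm_def W_def)
    \<comment> \<open>The factor 2 on the left is given away.\<close>
    finally have "\<bar>(LINT y|lebesgue. \<bar>J (x - y)\<bar> * L y) - L1_norm J * L x\<bar>
        \<le> C * weighted_L1_norm (2 + \<bar>b\<bar>) J / \<eta> * L x"
      by (rule order_trans[rotated]) (simp add: abs_mult)
    with conv_int show "integrable lebesgue (\<lambda>y. \<bar>J (x - y)\<bar> * scaled_bracket \<eta> y powr b) \<and>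
        \<bar>(LINT y|lebesgue. \<bar>J (x - y)\<bar> * scaled_bracket \<eta> y powr b) - L1_norm J * scaled_bracket \<eta> x powr b\<bar>
        \<le> C * weighted_L1_norm (2 + \<bar>b\<bar>) J / \<eta> * scaled_bracket \<eta> x powr b"
      by (simp add: L_def)
  qed
  with C0 show ?thesis using that by blast
qed

text \<open>All weights equal 1, and reflection invariance makes the convolution integral exactly
  the norm of \<open>J\<close>, so there is no error.\<close>

lemma convolution_estimate_exponent_0:
  fixes J :: "real ^ 'n \<Rightarrow> real"
  assumes "J \<in> weighted_L1 0"
  shows "convolution_estimate J 0 0"
proof -
  have J: "integrable lebesgue (\<lambda>z. \<bar>J z\<bar>)"
    using assms weighted_L1_0_integrable by blast
  have "scaled_bracket \<eta> x powr 0 = 1" if "\<eta> \<ge> 2" for \<eta> and x :: "real ^ 'n"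
    using scaled_bracket_pos[of \<eta> x] that by simp
  then show ?thesis
    using J integral_lebesgue_reflection[OF borel_measurable_integrable[OF J]]
      integrable_lebesgue_reflection_iff[of "\<lambda>z. \<bar>J z\<bar>"]
    by (simp add: convolution_estimate_def L1_norm_def)
qed

theorem theorem3p2:
  fixes b :: real
  shows "(\<forall>\<delta>\<^sub>0 (J :: real ^ 'n \<Rightarrow> real).
            \<delta>\<^sub>0 \<ge> 2 \<and> J \<in> weighted_L1 \<delta>\<^sub>0 \<and> radially_symmetric J \<and> \<bar>b\<bar> \<le> \<delta>\<^sub>0 - 2 \<longrightarrow>
            (\<exists>d>0. convolution_estimate J b d)) \<and>
         (\<exists>C\<ge>0. (b = 0 \<longrightarrow> C = 0) \<and>
            (\<forall>\<delta>\<^sub>0 (J :: real ^ 'n \<Rightarrow> real).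
               \<delta>\<^sub>0 \<ge> 2 \<and> J \<in> weighted_L1 \<delta>\<^sub>0 \<and> radially_symmetric J \<and> \<bar>b\<bar> \<le> \<delta>\<^sub>0 - 2 \<longrightarrow>
               convolution_estimate J b (C * weighted_L1_norm (2 + \<bar>b\<bar>) J)))"
proof -
  obtain C where C0: "C \<ge> 0" and C: "\<And>J :: real ^ 'n \<Rightarrow> real.
      J \<in> weighted_L1 (2 + \<bar>b\<bar>) \<Longrightarrow> radially_symmetric J \<Longrightarrow>
      convolution_estimate J b (C * weighted_L1_norm (2 + \<bar>b\<bar>) J)"
    using convolution_estimate_radial[of b] by blast
  \<comment> \<open>The constant built in \<open>second_difference_bound\<close> is positive even at
    exponent 0, so the value 0 for b = 0 is imposed here and justified by the exact case.\<close>
  define C' where "C' = (if b = 0 then 0 else C)"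
  have est: "convolution_estimate J b (C' * weighted_L1_norm (2 + \<bar>b\<bar>) J)"
    if "J \<in> weighted_L1 \<delta>" "radially_symmetric J" "\<bar>b\<bar> \<le> \<delta> - 2" for \<delta> and J :: "real ^ 'n \<Rightarrow> real"
  proof (cases "b = 0")
    case True
    with that show ?thesis
      using weighted_L1_mono[of J \<delta> 0] convolution_estimate_exponent_0[of J] by (simp add: C'_def)
  next
    case False
    with that show ?thesis
      using C[of J] weighted_L1_mono[of J \<delta> "2 + \<bar>b\<bar>"] by (simp add: C'_def)
  qed
  have "\<exists>d>0. convolution_estimate J b d"
    if "J \<in> weighted_L1 \<delta>" "radially_symmetric J" "\<bar>b\<bar> \<le> \<delta> - 2" for \<delta> and J :: "real ^ 'n \<Rightarrow> real"
    \<comment> \<open>The product of \<open>C'\<close> and the weighted norm may vanish; its maximum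
      with 1 is a positive admissible d.\<close>
    using convolution_estimate_mono[OF est[OF that] max.cobounded1[of _ 1]]
    by (intro exI[of _ "max (C' * weighted_L1_norm (2 + \<bar>b\<bar>) J) 1"]) simp
  moreover have "C' \<ge> 0" "b = 0 \<longrightarrow> C' = 0" using C0 by (simp_all add: C'_def)
  ultimately show ?thesis using est by blast
qed

end
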